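(* Let $I\subseteq\mathbb{R}$ be an open interval and let $c,\mu,b\in\mathbb{R}$. Let $G,w,f$ be sufficiently smooth (say $C^3$) real functions on $I$ with $w'\neq 0$ on $I$, $f(I)\subseteq I$ and $f'>0$ on $I$. Suppose there are real constants $K,\alpha,\beta,\gamma,\delta$ with $\alpha\delta-\beta\gamma\neq 0$ such that, for all $x\in I$, $\gamma w(x)+\delta\neq 0$ and $$G(f(x))=G(x)+K,\qquad w(f(x))=\frac{\alpha w(x)+\beta}{\gamma w(x)+\delta}.$$ Let the functions $V,g:I\to\mathbb{R}$ be given by $$2(V(x)-\mu)=-\tfrac12\{w,x\},\qquad 2g(x)=b\,(G'(x))^3 .$$ If $r_0:I\to\mathbb{R}$ is a twice differentiable, nowhere vanishing solution on $I$ of $$r''(x)=\frac{c^2}{r(x)^3}+2(V(x)-\mu)\,r(x)+2g(x)\,r(x)^3, \qquad (\ast)$$ then every twice differentiable function $r_1:I\to\mathbb{R}$ satisfying $$r_1(x)^2 f'(x)-r_0(f(x))^2=0\qquad\text{for all }x\in I$$ is also a solution of $(\ast)$ on $I$.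
   Context: For a $C^3$ function $h$ with $h'\neq0$, the Schwarzian derivative is $\{h,x\}:=\frac{h'''}{h'}-\frac32\left(\frac{h''}{h'}\right)^2$. Equation $(\ast)$ is the ordinary differential equation obtained from the Gross-Pitaevskii equation $\mathrm{i}\,\partial_t\psi=-\frac12\partial_x^2\psi+V(x)\psi+g(x)|\psi|^2\psi$ by the ansatz $\psi(x,t)=r(x)e^{\mathrm{i}(\theta(x)-\mu t)}$ with $r,\theta,\mu$ real, where $r^2\theta'=c$. A map sending solutions of an equation to solutions of the same equation, such as $r_0\mapsto r_1$, is called an auto-Bäcklund transformation. *)

theory Defs
  imports "HOL-Analysis.Analysis"
begin

text \<open>
  A function on \<open>I\<close> is rendered as a total function \<^typ>\<open>real \<Rightarrow> real\<close>. These notions are used for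
  open \<open>I\<close> only; there the iterated \<^term>\<open>deriv\<close> at points of \<open>I\<close> are the classical derivatives
  and do not depend on values outside \<open>I\<close>.
\<close>

definition times_differentiable_on :: "nat \<Rightarrow> (real \<Rightarrow> real) \<Rightarrow> real set \<Rightarrow> bool" where
  "times_differentiable_on n h I \<longleftrightarrow> (\<forall>k<n. (deriv ^^ k) h differentiable_on I)"

definition C_on :: "nat \<Rightarrow> (real \<Rightarrow> real) \<Rightarrow> real set \<Rightarrow> bool" where
  "C_on n h I \<longleftrightarrow> times_differentiable_on n h I \<and> continuous_on I ((deriv ^^ n) h)"

definition schwarzian :: "(real \<Rightarrow> real) \<Rightarrow> real \<Rightarrow> real" where
  "schwarzian h x =
     (deriv ^^ 3) h x / deriv h x - 3 / 2 * ((deriv ^^ 2) h x / deriv h x)\<^sup>2"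

text \<open>
  Solutions of \<open>r'' = c\<^sup>2 / r\<^sup>3 + 2 (V - \<mu>) r + 2 g r\<^sup>3\<close> on \<open>I\<close>. The condition \<^term>\<open>r x \<noteq> 0\<close>
  is what makes the quotient meaningful; without it \<open>c\<^sup>2 / 0 = 0\<close> would be read into the
  equation at zeros of \<open>r\<close>.
\<close>

definition amplitude_solution ::
  "real \<Rightarrow> real \<Rightarrow> (real \<Rightarrow> real) \<Rightarrow> (real \<Rightarrow> real) \<Rightarrow> real set \<Rightarrow> (real \<Rightarrow> real) \<Rightarrow> bool" where
  "amplitude_solution c \<mu> V g I r \<longleftrightarrow>
     times_differentiable_on 2 r I \<and>
     (\<forall>x\<in>I. r x \<noteq> 0 \<and>
        (deriv ^^ 2) r x = c\<^sup>2 / (r x) ^ 3 + 2 * (V x - \<mu>) * r x + 2 * g x * (r x) ^ 3)"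

end

theory Submission
  imports Defs
begin

text \<open>
  Invariance of the Schwarzian under Moebius maps and its chain rule turn the functional equation
  for \<open>w\<close> into \<open>{w,x} = {w,f(x)} f'(x)\<^sup>2 + {f,x}\<close>, so \<open>V\<close> transforms exactly like the potential under
  the Liouville substitution \<open>r\<^sub>0(f) = r\<^sub>1 (f')\<^sup>1\<^sup>/\<^sup>2\<close>, while \<open>G' = G'(f) f'\<close> gives \<open>g = g(f) (f')\<^sup>3\<close>.
  The relation between \<open>r\<^sub>0\<close> and \<open>r\<^sub>1\<close> is differentiated twice in its squared form, which avoids
  choosing a sign of \<open>r\<^sub>1\<close>.
\<close>

lemma times_differentiable_on_has_derivative:
  assumes "times_differentiable_on n h I" "open I" "x \<in> I" "k < n"
  shows "((deriv ^^ k) h has_real_derivative (deriv ^^ Suc k) h x) (at x)"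
proof -
  have "(deriv ^^ k) h differentiable_on I"
    using assms(1,4) unfolding times_differentiable_on_def by blast
  then have "(deriv ^^ k) h differentiable at x"
    using assms(2,3) differentiable_on_eq_differentiable_at by blast
  then show ?thesis
    unfolding funpow.simps o_apply DERIV_deriv_iff_real_differentiable .
qed

lemma has_derivatives_1_2:
  assumes "times_differentiable_on 2 h I" "open I" "x \<in> I"
  shows "(h has_real_derivative deriv h x) (at x)"
    and "(deriv h has_real_derivative deriv (deriv h) x) (at x)"
  using times_differentiable_on_has_derivative[OF assms, where k = 0]
    times_differentiable_on_has_derivative[OF assms, where k = 1]
  unfolding One_nat_def numeral_2_eq_2 funpow.simps o_apply id_apply by blast+

lemma has_derivatives_1_2_3:
  assumes "times_differentiable_on 3 h I" "open I" "x \<in> I"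
  shows "(h has_real_derivative deriv h x) (at x)"
    and "(deriv h has_real_derivative deriv (deriv h) x) (at x)"
    and "(deriv (deriv h) has_real_derivative deriv (deriv (deriv h)) x) (at x)"
  using times_differentiable_on_has_derivative[OF assms, where k = 0]
    times_differentiable_on_has_derivative[OF assms, where k = 1]
    times_differentiable_on_has_derivative[OF assms, where k = 2]
  unfolding One_nat_def numeral_2_eq_2 numeral_3_eq_3 funpow.simps o_apply id_apply by blast+

text \<open>This is the device for differentiating an identity known only on the open set
  \<open>I\<close>: agreement near \<open>x\<close> transfers one derivative to the other function,
  and uniqueness of derivatives does the rest.\<close>

lemma derivatives_eq_on_open:
  fixes F H :: "real \<Rightarrow> real"
  assumes "open I" "x \<in> I" "\<And>y. y \<in> I \<Longrightarrow> F y = H y"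
    and "(F has_real_derivative a) (at x)" "(H has_real_derivative d) (at x)"
  shows "a = d"
  using DERIV_unique[OF has_field_derivative_transform_within_open[OF assms(4,1,2,3)] assms(5)] by simp

lemma schwarzian_eqI:
  assumes "open I" "x \<in> I"
    and h1: "\<And>y. y \<in> I \<Longrightarrow> (h has_real_derivative h1 y) (at y)"
    and h2: "\<And>y. y \<in> I \<Longrightarrow> (h1 has_real_derivative h2 y) (at y)"
    and h3: "\<And>y. y \<in> I \<Longrightarrow> (h2 has_real_derivative h3 y) (at y)"
  shows "schwarzian h x = h3 x / h1 x - 3 / 2 * (h2 x / h1 x)\<^sup>2"
proof -
  have d1: "deriv h y = h1 y" if "y \<in> I" for y
    using h1[OF that] by (rule DERIV_imp_deriv)
  \<comment> \<open>\<open>deriv h\<close> and \<open>h1\<close> agree only on \<open>I\<close>.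
    Openness makes this agreement local around each point of \<open>I\<close>, so it survives one
    more differentiation; the same argument gives the third order.\<close>
  have d2: "deriv (deriv h) y = h2 y" if "y \<in> I" for y
    using has_field_derivative_transform_within_open[OF h2[OF that] \<open>open I\<close> that] d1
    by (intro DERIV_imp_deriv) simp
  have d3: "deriv (deriv (deriv h)) y = h3 y" if "y \<in> I" for y
    using has_field_derivative_transform_within_open[OF h3[OF that] \<open>open I\<close> that] d2
    by (intro DERIV_imp_deriv) simp
  show ?thesis
    using \<open>x \<in> I\<close> by (simp add: schwarzian_def numeral_3_eq_3 numeral_2_eq_2 d1 d2 d3)
qed

lemma schwarzian_cong_open:
  assumes "open I" "x \<in> I" "\<And>y. y \<in> I \<Longrightarrow> h y = k y"
  shows "schwarzian h x = schwarzian k x"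
proof -
  have "eventually (\<lambda>y. h y = k y) (nhds x)"
    using assms eventually_nhds by blast
  then have "(deriv ^^ n) h x = (deriv ^^ n) k x" for n
    by (rule higher_deriv_cong_ev) simp
  from this[of 1] this[of 2] this[of 3] show ?thesis
    by (simp add: schwarzian_def)
qed

text \<open>With \<open>h\<close> the composite, h''/h' = (w''/w')(f) f' + f''/f'. The mixed term 3
  (w''/w')(f) f'' of h'''/h' is exactly cancelled by the one from -3/2 times the square of this, so
  only the two Schwarzians remain.\<close>

lemma schwarzian_compose:
  assumes "open I" "open J" "x \<in> I" "f ` I \<subseteq> J"
    and w: "times_differentiable_on 3 w J" and f: "times_differentiable_on 3 f I"
    and "deriv w (f x) \<noteq> 0" "deriv f x \<noteq> 0"
  shows "schwarzian (\<lambda>y. w (f y)) x = schwarzian w (f x) * (deriv f x)\<^sup>2 + schwarzian f x"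
proof -
  note f' = has_derivatives_1_2_3[OF f \<open>open I\<close>]
  have w': "((\<lambda>y. w (f y)) has_real_derivative deriv w (f y) * deriv f y) (at y)"
    "((\<lambda>y. deriv w (f y)) has_real_derivative deriv (deriv w) (f y) * deriv f y) (at y)"
    "((\<lambda>y. deriv (deriv w) (f y)) has_real_derivative deriv (deriv (deriv w)) (f y) * deriv f y) (at y)"
    if "y \<in> I" for y
  proof -
    have "f y \<in> J" using that \<open>f ` I \<subseteq> J\<close> by blast
    note w3 = has_derivatives_1_2_3[OF w \<open>open J\<close> this]
    show "((\<lambda>y. w (f y)) has_real_derivative deriv w (f y) * deriv f y) (at y)"
      "((\<lambda>y. deriv w (f y)) has_real_derivative deriv (deriv w) (f y) * deriv f y) (at y)"
      "((\<lambda>y. deriv (deriv w) (f y)) has_real_derivative deriv (deriv (deriv w)) (f y) * deriv f y) (at y)"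
      by (rule DERIV_chain2[OF w3(1) f'(1)[OF that]] DERIV_chain2[OF w3(2) f'(1)[OF that]]
          DERIV_chain2[OF w3(3) f'(1)[OF that]])+
  qed
  have 2: "((\<lambda>y. deriv w (f y) * deriv f y) has_real_derivative
      deriv (deriv w) (f y) * deriv f y ^ 2 + deriv w (f y) * deriv (deriv f) y) (at y)"
    if "y \<in> I" for y
    by (rule derivative_eq_intros w' f' that refl)+ (simp add: power2_eq_square)
  have 3: "((\<lambda>y. deriv (deriv w) (f y) * deriv f y ^ 2 + deriv w (f y) * deriv (deriv f) y)
      has_real_derivative deriv (deriv (deriv w)) (f y) * deriv f y ^ 3
        + 3 * deriv (deriv w) (f y) * deriv f y * deriv (deriv f) y
        + deriv w (f y) * deriv (deriv (deriv f)) y) (at y)"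
    if "y \<in> I" for y
    by (rule derivative_eq_intros w' f' that refl)+ (simp add: eval_nat_numeral algebra_simps)
  have "schwarzian (\<lambda>y. w (f y)) x =
    (deriv (deriv (deriv w)) (f x) * deriv f x ^ 3
      + 3 * deriv (deriv w) (f x) * deriv f x * deriv (deriv f) x
      + deriv w (f x) * deriv (deriv (deriv f)) x) / (deriv w (f x) * deriv f x)
    - 3 / 2 * ((deriv (deriv w) (f x) * deriv f x ^ 2 + deriv w (f x) * deriv (deriv f) x)
        / (deriv w (f x) * deriv f x))\<^sup>2"
    by (rule schwarzian_eqI[OF \<open>open I\<close> \<open>x \<in> I\<close> w'(1) 2 3])
  also have "\<dots> = schwarzian w (f x) * (deriv f x)\<^sup>2 + schwarzian f x"
    using assms(7,8)
    by (simp add: schwarzian_def field_simps eval_nat_numeral)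
  finally show ?thesis .
qed

text \<open>With \<open>h\<close> the transformed function and \<open>P\<close> the denominator,
  h''/h' = w''/w' - 2 \<gamma> w'/P. The terms 6 \<gamma> w''/P and 6 \<gamma>^2 w'^2/P^2 occur in
  h'''/h' and in 3/2 (h''/h')^2 with signs that cancel. The affine case \<gamma> = 0 is
  included.\<close>

lemma schwarzian_moebius:
  assumes "open I" "x \<in> I" and w: "times_differentiable_on 3 w I"
    and "deriv w x \<noteq> 0" and nz: "\<And>y. y \<in> I \<Longrightarrow> \<gamma> * w y + \<delta> \<noteq> 0" and D: "\<alpha> * \<delta> - \<beta> * \<gamma> \<noteq> 0"
  shows "schwarzian (\<lambda>y. (\<alpha> * w y + \<beta>) / (\<gamma> * w y + \<delta>)) x = schwarzian w x"
proof -
  define D where "D = \<alpha> * \<delta> - \<beta> * \<gamma>"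
  define P where "P y = \<gamma> * w y + \<delta>" for y
  note w' = has_derivatives_1_2_3[OF w \<open>open I\<close>]
  have P0: "P y \<noteq> 0" if "y \<in> I" for y
    using nz[OF that] by (simp add: P_def)
  have P': "(P has_real_derivative \<gamma> * deriv w y) (at y)" if "y \<in> I" for y
    unfolding P_def by (auto intro!: derivative_eq_intros w' that)
  \<comment> \<open>The numerator \<alpha> P - \<gamma> (\<alpha> w + \<beta>) of the quotient rule
    collapses to the constant \<open>D\<close>. It stays a common factor of all higher derivatives
    and cancels in the ratios of the Schwarzian.\<close>
  have 1: "((\<lambda>y. (\<alpha> * w y + \<beta>) / P y) has_real_derivative D * (deriv w y / P y ^ 2)) (at y)"
    if "y \<in> I" for y
    by (rule derivative_eq_intros w' P' that P0 refl)+
      (use P0[OF that] in \<open>simp add: divide_simps power2_eq_square\<close>,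
       simp add: P_def D_def algebra_simps)
  have 2: "((\<lambda>y. D * (deriv w y / P y ^ 2)) has_real_derivative
      D * (deriv (deriv w) y / P y ^ 2 - 2 * \<gamma> * deriv w y ^ 2 / P y ^ 3)) (at y)"
    if "y \<in> I" for y
    using P0[OF that]
    by (auto intro!: derivative_eq_intros w' P' that simp: field_simps eval_nat_numeral)
  have 3: "((\<lambda>y. D * (deriv (deriv w) y / P y ^ 2 - 2 * \<gamma> * deriv w y ^ 2 / P y ^ 3))
      has_real_derivative D * (deriv (deriv (deriv w)) y / P y ^ 2
        - 6 * \<gamma> * deriv w y * deriv (deriv w) y / P y ^ 3
        + 6 * \<gamma> ^ 2 * deriv w y ^ 3 / P y ^ 4)) (at y)"
    if "y \<in> I" for y
    using P0[OF that]
    by (auto intro!: derivative_eq_intros w' P' that simp: field_simps eval_nat_numeral)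
  have "D \<noteq> 0" using D by (simp add: D_def)
  have "schwarzian (\<lambda>y. (\<alpha> * w y + \<beta>) / P y) x =
      D * (deriv (deriv (deriv w)) x / P x ^ 2 - 6 * \<gamma> * deriv w x * deriv (deriv w) x / P x ^ 3
        + 6 * \<gamma> ^ 2 * deriv w x ^ 3 / P x ^ 4) / (D * (deriv w x / P x ^ 2))
      - 3 / 2 * (D * (deriv (deriv w) x / P x ^ 2 - 2 * \<gamma> * deriv w x ^ 2 / P x ^ 3)
        / (D * (deriv w x / P x ^ 2)))\<^sup>2"
    by (rule schwarzian_eqI[OF \<open>open I\<close> \<open>x \<in> I\<close> 1 2 3])
  also have "\<dots> = schwarzian w x"
    using \<open>D \<noteq> 0\<close> P0[OF \<open>x \<in> I\<close>] \<open>deriv w x \<noteq> 0\<close>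
    by (simp add: schwarzian_def field_simps eval_nat_numeral)
  finally have "schwarzian (\<lambda>y. (\<alpha> * w y + \<beta>) / P y) x = schwarzian w x" .
  then show ?thesis by (simp add: P_def)
qed

text \<open>The pointwise algebra of the Liouville substitution. \<open>R\<close>, \<open>p\<close>,
  \<open>q\<close> stand for \<open>r\<^sub>0\<close> and its first two derivatives at f(x),
  \<open>r\<close>, \<open>r'\<close>, \<open>r''\<close> for those of \<open>r\<^sub>1\<close> at
  x, and \<open>f1\<close>, \<open>f2\<close>, \<open>f3\<close> for the derivatives of
  \<open>f\<close> at x. The premises \<open>e0\<close>, \<open>e1\<close>, \<open>e2\<close> are
  the squared relation and its two derivatives; \<open>A\<close> and \<open>B\<close> are the
  coefficients of the equation at f(x). The bracket subtracted from A f1^2, with its factor 1/2, is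
  half the Schwarzian of \<open>f\<close>.\<close>

lemma liouville_amplitude_algebra:
  fixes R r r' r'' p q f1 f2 f3 A B c :: real
  assumes "R \<noteq> 0" "f1 > 0"
    and e0: "r\<^sup>2 * f1 = R\<^sup>2"
    and e1: "2 * r * r' * f1 + r\<^sup>2 * f2 = 2 * R * (p * f1)"
    and e2: "2 * (r'\<^sup>2 + r * r'') * f1 + 4 * r * r' * f2 + r\<^sup>2 * f3
      = 2 * ((p * f1)\<^sup>2 + R * (q * f1\<^sup>2 + p * f2))"
    and q: "q = c\<^sup>2 / R ^ 3 + A * R + B * R ^ 3"
  shows "r'' = c\<^sup>2 / r ^ 3 + (A * f1\<^sup>2 - 1 / 2 * (f3 / f1 - 3 / 2 * (f2 / f1)\<^sup>2)) * r + B * f1 ^ 3 * r ^ 3"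
proof -
  have "r \<noteq> 0" using e0 assms(1,2) by auto
  \<comment> \<open>Only the products R p and R q and the square p^2 are ever solved for. Each is
    unchanged when \<open>R\<close>, \<open>p\<close>, \<open>q\<close> all change sign, so no
    square root of \<open>f1\<close> and no sign of r/R enters.\<close>
  have Rp: "R * p = r * r' + r\<^sup>2 * f2 / (2 * f1)"
    using e1 \<open>f1 > 0\<close> by (simp add: field_simps)
  \<comment> \<open>After multiplication by \<open>R\<close> the equation contains only even powers
    of \<open>R\<close>, which \<open>e0\<close> turns into powers of r^2 f1.\<close>
  have Rq: "R * q = c\<^sup>2 / (r\<^sup>2 * f1) + A * (r\<^sup>2 * f1) + B * (r\<^sup>2 * f1)\<^sup>2"
    unfolding e0 q using \<open>R \<noteq> 0\<close> by (simp add: field_simps eval_nat_numeral)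
  \<comment> \<open>The left side is (R p)^2 by \<open>e0\<close>. Cancelling r^2 from both sides
    isolates the p^2 that \<open>e2\<close> needs.\<close>
  have "r\<^sup>2 * f1 * p\<^sup>2 = (r * r' + r\<^sup>2 * f2 / (2 * f1))\<^sup>2"
    unfolding e0 Rp[symmetric] by (simp add: power_mult_distrib)
  also have "\<dots> = r\<^sup>2 * (r' + r * f2 / (2 * f1))\<^sup>2"
    by (simp add: power2_eq_square algebra_simps)
  finally have pp: "f1 * p\<^sup>2 = (r' + r * f2 / (2 * f1))\<^sup>2"
    using \<open>r \<noteq> 0\<close> by simp
  have "2 * r * f1 * r'' = 2 * f1 * (f1 * p\<^sup>2) + 2 * (R * q) * f1\<^sup>2 + 2 * (R * p) * f2
      - 2 * r'\<^sup>2 * f1 - 4 * r * r' * f2 - r\<^sup>2 * f3"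
    using e2 by (simp add: algebra_simps power2_eq_square)
  also have "\<dots> = 2 * r * f1 * (c\<^sup>2 / r ^ 3
      + (A * f1\<^sup>2 - 1 / 2 * (f3 / f1 - 3 / 2 * (f2 / f1)\<^sup>2)) * r + B * f1 ^ 3 * r ^ 3)"
    unfolding pp Rq Rp using \<open>r \<noteq> 0\<close> \<open>f1 > 0\<close> by (simp add: field_simps eval_nat_numeral)
  finally show ?thesis using \<open>r \<noteq> 0\<close> \<open>f1 > 0\<close> by simp
qed

theorem mainTheorem1:
  fixes I :: "real set"
    and c \<mu> b K \<alpha> \<beta> \<gamma> \<delta> :: real
    and G w f V g r\<^sub>0 r\<^sub>1 :: "real \<Rightarrow> real"
  assumes "open I" and "is_interval I"
    and "C_on 3 G I" and "C_on 3 w I" and "C_on 3 f I"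
    and "\<And>x. x \<in> I \<Longrightarrow> deriv w x \<noteq> 0"
    and "f ` I \<subseteq> I"
    and "\<And>x. x \<in> I \<Longrightarrow> deriv f x > 0"
    and "\<alpha> * \<delta> - \<beta> * \<gamma> \<noteq> 0"
    and "\<And>x. x \<in> I \<Longrightarrow> \<gamma> * w x + \<delta> \<noteq> 0"
    and "\<And>x. x \<in> I \<Longrightarrow> G (f x) = G x + K"
    and "\<And>x. x \<in> I \<Longrightarrow> w (f x) = (\<alpha> * w x + \<beta>) / (\<gamma> * w x + \<delta>)"
    and "\<And>x. x \<in> I \<Longrightarrow> 2 * (V x - \<mu>) = - (1 / 2) * schwarzian w x"
    and "\<And>x. x \<in> I \<Longrightarrow> 2 * g x = b * (deriv G x) ^ 3"
    and "amplitude_solution c \<mu> V g I r\<^sub>0"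
    and "\<And>x. x \<in> I \<Longrightarrow> r\<^sub>0 x \<noteq> 0"
    and "times_differentiable_on 2 r\<^sub>1 I"
    and "\<And>x. x \<in> I \<Longrightarrow> (r\<^sub>1 x)\<^sup>2 * deriv f x - (r\<^sub>0 (f x))\<^sup>2 = 0"
  shows "amplitude_solution c \<mu> V g I r\<^sub>1"
proof -
  have G: "times_differentiable_on 3 G I" and w: "times_differentiable_on 3 w I"
    and f: "times_differentiable_on 3 f I"
    using assms(3-5) by (simp_all add: C_on_def)
  have r0: "times_differentiable_on 2 r\<^sub>0 I"
    using assms(15) by (simp add: amplitude_solution_def)
  note r1 = assms(17)
  note f' = has_derivatives_1_2_3[OF f \<open>open I\<close>]
  note r1' = has_derivatives_1_2[OF r1 \<open>open I\<close>]
  have fI: "f x \<in> I" if "x \<in> I" for x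
    using that assms(7) by blast
  note r0f = DERIV_chain2[OF has_derivatives_1_2(1)[OF r0 \<open>open I\<close> fI] f'(1)]
    DERIV_chain2[OF has_derivatives_1_2(2)[OF r0 \<open>open I\<close> fI] f'(1)]
  have "r\<^sub>1 x \<noteq> 0 \<and> (deriv ^^ 2) r\<^sub>1 x =
      c\<^sup>2 / (r\<^sub>1 x) ^ 3 + 2 * (V x - \<mu>) * r\<^sub>1 x + 2 * g x * (r\<^sub>1 x) ^ 3" if x: "x \<in> I" for x
  proof -
    have e0: "(r\<^sub>1 y)\<^sup>2 * deriv f y = (r\<^sub>0 (f y))\<^sup>2" if "y \<in> I" for y
      using assms(18)[OF that] by simp
    \<comment> \<open>Stated on all of \<open>I\<close>, since it is differentiated once more to
      obtain \<open>e2\<close>; the latter is needed at \<open>x\<close> alone.\<close>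
    have e1: "2 * r\<^sub>1 y * deriv r\<^sub>1 y * deriv f y + (r\<^sub>1 y)\<^sup>2 * deriv (deriv f) y
        = 2 * r\<^sub>0 (f y) * (deriv r\<^sub>0 (f y) * deriv f y)" if "y \<in> I" for y
      by (rule derivatives_eq_on_open[OF \<open>open I\<close> that e0])
        (auto intro!: derivative_eq_intros r1' f' r0f that)
    have e2: "2 * ((deriv r\<^sub>1 x)\<^sup>2 + r\<^sub>1 x * deriv (deriv r\<^sub>1) x) * deriv f x
          + 4 * r\<^sub>1 x * deriv r\<^sub>1 x * deriv (deriv f) x + (r\<^sub>1 x)\<^sup>2 * deriv (deriv (deriv f)) x
        = 2 * ((deriv r\<^sub>0 (f x) * deriv f x)\<^sup>2 + r\<^sub>0 (f x) *
            (deriv (deriv r\<^sub>0) (f x) * (deriv f x)\<^sup>2 + deriv r\<^sub>0 (f x) * deriv (deriv f) x))"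
      by (rule derivatives_eq_on_open[OF \<open>open I\<close> x e1])
        (auto intro!: derivative_eq_intros r1' f' r0f x simp: power2_eq_square algebra_simps)
    have q: "deriv (deriv r\<^sub>0) (f x) = c\<^sup>2 / (r\<^sub>0 (f x)) ^ 3
        + (2 * (V (f x) - \<mu>)) * r\<^sub>0 (f x) + (2 * g (f x)) * (r\<^sub>0 (f x)) ^ 3"
      using assms(15) fI[OF x] by (simp add: amplitude_solution_def numeral_2_eq_2)
    \<comment> \<open>The Schwarzian of the composite of \<open>w\<close> with \<open>f\<close> is
      evaluated twice: by the chain rule, and as that of a Moebius image of
      \<open>w\<close>.\<close>
    have "schwarzian w (f x) * (deriv f x)\<^sup>2 + schwarzian f x = schwarzian (\<lambda>y. w (f y)) x"
      using schwarzian_compose[OF \<open>open I\<close> \<open>open I\<close> x assms(7) w f]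
        assms(6)[OF fI[OF x]] assms(8)[OF x] by simp
    also have "\<dots> = schwarzian (\<lambda>y. (\<alpha> * w y + \<beta>) / (\<gamma> * w y + \<delta>)) x"
      by (rule schwarzian_cong_open[OF \<open>open I\<close> x assms(12)])
    also have "\<dots> = schwarzian w x"
      by (rule schwarzian_moebius[OF \<open>open I\<close> x w assms(6)[OF x] assms(10) assms(9)])
    \<comment> \<open>Multiplying by -1/2 gives exactly the coefficient of \<open>r\<close> in
      \<open>liouville_amplitude_algebra\<close> with A = 2 (V(f(x)) - \<mu>).\<close>
    finally have V: "2 * (V x - \<mu>) = 2 * (V (f x) - \<mu>) * (deriv f x)\<^sup>2 - 1 / 2 * schwarzian f x"
      unfolding assms(13)[OF x] assms(13)[OF fI[OF x]] by (simp add: algebra_simps)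
    \<comment> \<open>Differentiation removes \<open>K\<close>; cubing the result gives the
      transformation law of \<open>g\<close>.\<close>
    have "deriv G (f x) * deriv f x = deriv G x"
      by (rule derivatives_eq_on_open[OF \<open>open I\<close> x assms(11)])
        (auto intro!: derivative_eq_intros has_derivatives_1_2_3[OF G \<open>open I\<close>] x
          DERIV_chain2[OF has_derivatives_1_2_3(1)[OF G \<open>open I\<close> fI] f'(1)])
    then have g: "2 * g x = 2 * g (f x) * deriv f x ^ 3"
      unfolding assms(14)[OF x] assms(14)[OF fI[OF x]] by (simp flip: power_mult_distrib)
    have "r\<^sub>1 x \<noteq> 0"
      using e0[OF x] assms(16)[OF fI[OF x]] by auto
    moreover have "deriv (deriv r\<^sub>1) x =
        c\<^sup>2 / (r\<^sub>1 x) ^ 3 + 2 * (V x - \<mu>) * r\<^sub>1 x + 2 * g x * (r\<^sub>1 x) ^ 3"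
      using liouville_amplitude_algebra[OF assms(16)[OF fI[OF x]] assms(8)[OF x] e0[OF x]
          e1[OF x] e2 q]
      unfolding V g by (simp add: schwarzian_def numeral_3_eq_3 numeral_2_eq_2)
    ultimately show ?thesis by (simp add: numeral_2_eq_2)
  qed
  with r1 show ?thesis by (simp add: amplitude_solution_def)
qed

end
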